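(* Let $E\subset\mathbb{R}^d$ be a non-autonomous affine set determined by matrices $T_{k,j}$ ($k\ge1$, $1\le j\le n_k$) satisfying the standing assumption $0<\alpha_-\le\alpha_+<1$, and let $s_A=\inf\{s\ge0:\mathcal{M}^s(\Sigma^\infty)=0\}$, where $\mathcal{M}^s$ is the net measure on $\Sigma^\infty$ built from the singular value function (see context). Then $$\dim_{\rm H}E\le\min\{s_A,d\}.$$
   Context: Let $\{n_k\}_{k\ge1}$ be integers with $n_k\ge2$. Put $\Sigma^k=\{u_1\cdots u_k:1\le u_j\le n_j\}$, $\Sigma^0=\{\emptyset\}$, $\Sigma^*=\bigcup_{k\ge0}\Sigma^k$, and let $\Sigma^\infty=\{u_1u_2\cdots:1\le u_k\le n_k\}$. For $\mathbf u\in\Sigma^*$, $\mathcal{C}_{\mathbf u}\subset\Sigma^\infty$ is the cylinder of infinite words beginning with $\mathbf u$, and $|\mathbf u|$ is the length of $\mathbf u$. Let $J\subset\mathbb{R}^d$ be compact with non-empty interior. For each $k\ge1$ let $\Xi_k=\{T_{k,1},\dots,T_{k,n_k}\}$ be a collection of real $d\times d$ matrices with $\|T_{k,j}\|<1$. For $\mathbf u=u_1\cdots u_k$ write $T_{\mathbf u}=T_{1,u_1}\cdots T_{k,u_k}$. Non-autonomous affine set: let $\mathcal{J}=\{J_{\mathbf u}:\mathbf u\in\Sigma^*\}$ be a collection of closed subsets of $J$ such that (1) $J_\emptyset=J$ and for all $k\ge1$, $\mathbf u\in\Sigma^{k-1}$, the sets $J_{\mathbf u1},\dots,J_{\mathbf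 un_k}$ are subsets of $J_{\mathbf u}$; (2) there are vectors $\omega_{\mathbf v}\in\mathbb{R}^d$ ($\mathbf v\in\Sigma^*\setminus\{\emptyset\}$) such that $J_{\mathbf u}=\Psi_{u_1}\circ\cdots\circ\Psi_{u_k}(J)$ for each $\mathbf u=u_1\cdots u_k$, where $\Psi_{u_j}(x)=T_{j,u_j}x+\omega_{u_1\cdots u_j}$; (3) $\lim_{k\to\infty}\max_{\mathbf u\in\Sigma^k}\operatorname{diam}J_{\mathbf u}=0$. Then $E=\bigcap_{k\ge1}\bigcup_{\mathbf u\in\Sigma^k}J_{\mathbf u}$ is the non-autonomous affine set determined by $\mathcal{J}$. Singular values of a matrix $T$ are $\alpha_1(T)\ge\dots\ge\alpha_d(T)$. Standing assumption: all $T_{k,i}$ are nonsingular and $0<\alpha_-\le\alpha_+<1$, where $\alpha_+=\sup_{k,i}\alpha_1(T_{k,i})$, $\alpha_-=\inf_{k,i}\alpha_d(T_{k,i})$. Singular value function: for $0<s\le d$, $\phi^s(T)=\alpha_1(T)\cdots\alpha_{m-1}(T)\alpha_m(T)^{s-m+1}$ with $m$ the integer such that $m-1<s\le m$; $\phi^0(T)=1$; for $s>d$, $\phi^s(T)=(\alpha_1(T)\cdots\alpha_d(T))^{s/d}$. For $s\ge0$, $G\subset\Sigma^\infty$ and $k\ge1$, $\mathcal{M}^s_{(k)}(G)=\inf\{\sum_{\mathbf u}\phi^s(T_{\mathbf u}):G\subset\bigcup_{\mathbf u}\mathcal{C}_{\mathbf u},\ |\mathbf u|\ge k\}$ (infimum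 over covers of $G$ by cylinders of words of length at least $k$), and $\mathcal{M}^s(G)=\lim_{k\to\infty}\mathcal{M}^s_{(k)}(G)$. One has $s_A=\inf\{s:\mathcal{M}^s(\Sigma^\infty)=0\}=\sup\{s:\mathcal{M}^s(\Sigma^\infty)=\infty\}$. $\dim_{\rm H}$ is Hausdorff dimension. *)

theory Defs
  imports "HOL-Analysis.Analysis"
begin

text \<open>
  \<^term>\<open>diameter\<close> of an unbounded set is a junk value, so covers are required to consist of bounded
  sets.  The case \<^term>\<open>s = 0\<close> is separate because \<^prop>\<open>0 powr 0 = (0::real)\<close>; with it,
  the zero-dimensional measure is counting measure.
\<close>

definition hausdorff_gauge :: "real \<Rightarrow> 'a::metric_space set \<Rightarrow> real" where
  "hausdorff_gauge s U = (if U = {} then 0 else if s = 0 then 1 else diameter U powr s)"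

definition hausdorff_premeasure :: "real \<Rightarrow> real \<Rightarrow> 'a::metric_space set \<Rightarrow> ennreal" where
  "hausdorff_premeasure s \<delta> A =
     Inf {\<Sum>i. ennreal (hausdorff_gauge s (U i)) | U :: nat \<Rightarrow> 'a set.
            A \<subseteq> (\<Union>i. U i) \<and> (\<forall>i. bounded (U i) \<and> diameter (U i) \<le> \<delta>)}"

definition hausdorff_measure :: "real \<Rightarrow> 'a::metric_space set \<Rightarrow> ennreal" where
  "hausdorff_measure s A = (SUP \<delta>\<in>{0<..}. hausdorff_premeasure s \<delta> A)"

definition hausdorff_dim :: "'a::metric_space set \<Rightarrow> ennreal" where
  "hausdorff_dim A = Inf {ennreal s | s. 0 \<le> s \<and> hausdorff_measure s A = 0}"

text \<open>
  The singular values of \<open>A\<close> are the nonnegative square roots of the eigenvalues of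
  \<open>A\<^sup>T A\<close>, counted with multiplicity (as roots of the characteristic polynomial)
  and listed in decreasing order.  Here \<^term>\<open>mat x\<close> is \<open>x\<close> times the identity.
\<close>

definition singular_values :: "real^'d^'d \<Rightarrow> real list" where
  "singular_values A = (THE \<sigma>. sorted_wrt (\<ge>) \<sigma> \<and> (\<forall>a\<in>set \<sigma>. 0 \<le> a) \<and>
     (\<forall>x. det (mat x - transpose A ** A) = (\<Prod>a\<leftarrow>\<sigma>. x - a\<^sup>2)))"

text \<open>Singular values are numbered from \<open>1\<close> to \<open>d\<close>.\<close>

definition sing_val :: "nat \<Rightarrow> real^'d^'d \<Rightarrow> real" where
  "sing_val i A = singular_values A ! (i - 1)"

definition sing_val_fun :: "real \<Rightarrow> real^'d^'d \<Rightarrow> real" where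
  "sing_val_fun s A =
     (if s = 0 then 1
      else if s \<le> real CARD('d) then
        (let m = nat \<lceil>s\<rceil> in
           (\<Prod>i = 1..m - 1. sing_val i A) * sing_val m A powr (s - real m + 1))
      else (\<Prod>i = 1..CARD('d). sing_val i A) powr (s / real CARD('d)))"

text \<open>
  The alphabet sizes \<open>n k\<close> and the matrices \<open>T k j\<close> are indexed by \<open>k \<ge> 1\<close> and
  \<open>1 \<le> j \<le> n k\<close>; values elsewhere are irrelevant.  Positions in words start at \<open>0\<close>,
  so the letter \<open>u\<^sub>k\<close> is \<^term>\<open>u ! (k - 1)\<close>.
\<close>

definition words :: "(nat \<Rightarrow> nat) \<Rightarrow> nat \<Rightarrow> nat list set" where
  "words n k = {u. length u = k \<and> (\<forall>j\<in>{1..k}. u ! (j - 1) \<in> {1..n j})}"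

definition fin_words :: "(nat \<Rightarrow> nat) \<Rightarrow> nat list set" where
  "fin_words n = (\<Union>k. words n k)"

definition inf_words :: "(nat \<Rightarrow> nat) \<Rightarrow> (nat \<Rightarrow> nat) set" where
  "inf_words n = {w. \<forall>j\<ge>1. w (j - 1) \<in> {1..n j}}"

definition cylinder :: "(nat \<Rightarrow> nat) \<Rightarrow> nat list \<Rightarrow> (nat \<Rightarrow> nat) set" where
  "cylinder n u = {w \<in> inf_words n. map w [0..<length u] = u}"

definition word_matrix :: "(nat \<Rightarrow> nat \<Rightarrow> real^'d^'d) \<Rightarrow> nat list \<Rightarrow> real^'d^'d" where
  "word_matrix T u = foldr (**) (map (\<lambda>j. T j (u ! (j - 1))) [1..<Suc (length u)]) (mat 1)"

text \<open>
  There are only countably many finite words, so arbitrary sets of words give exactly the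
  countable covers by cylinders.
\<close>

definition net_premeasure ::
    "(nat \<Rightarrow> nat) \<Rightarrow> (nat \<Rightarrow> nat \<Rightarrow> real^'d^'d) \<Rightarrow> real \<Rightarrow> nat \<Rightarrow> (nat \<Rightarrow> nat) set \<Rightarrow> ennreal" where
  "net_premeasure n T s k G =
     Inf {(\<Sum>\<^sub>\<infinity>u\<in>C. ennreal (sing_val_fun s (word_matrix T u))) | C.
            C \<subseteq> fin_words n \<and> (\<forall>u\<in>C. k \<le> length u) \<and> G \<subseteq> (\<Union>u\<in>C. cylinder n u)}"

definition net_measure ::
    "(nat \<Rightarrow> nat) \<Rightarrow> (nat \<Rightarrow> nat \<Rightarrow> real^'d^'d) \<Rightarrow> real \<Rightarrow> (nat \<Rightarrow> nat) set \<Rightarrow> ennreal" where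
  "net_measure n T s G = lim (\<lambda>k. net_premeasure n T s k G)"

lemma incseq_net_premeasure: "incseq (\<lambda>k. net_premeasure n T s k G)"
  unfolding incseq_def net_premeasure_def
  by (intro allI impI Inf_superset_mono) (blast intro: order_trans)

lemma net_measure_eq_SUP: "net_measure n T s G = (SUP k. net_premeasure n T s k G)"
  unfolding net_measure_def
  by (intro limI LIMSEQ_SUP incseq_net_premeasure)

text \<open>The value is \<open>\<infinity>\<close> if the net measure of \<^term>\<open>inf_words n\<close> never vanishes.\<close>

definition affinity_dim :: "(nat \<Rightarrow> nat) \<Rightarrow> (nat \<Rightarrow> nat \<Rightarrow> real^'d^'d) \<Rightarrow> ennreal" where
  "affinity_dim n T = Inf {ennreal s | s. 0 \<le> s \<and> net_measure n T s (inf_words n) = 0}"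

text \<open>The map \<open>\<Psi>\<^sub>u\<^sub>j\<close> for a word \<open>u\<close>; its translation depends on the whole prefix
  \<open>u\<^sub>1 \<dots> u\<^sub>j\<close>.\<close>

definition affine_step ::
    "(nat \<Rightarrow> nat \<Rightarrow> real^'d^'d) \<Rightarrow> (nat list \<Rightarrow> real^'d) \<Rightarrow> nat list \<Rightarrow> nat \<Rightarrow> real^'d \<Rightarrow> real^'d" where
  "affine_step T \<omega> u j x = T j (u ! (j - 1)) *v x + \<omega> (take j u)"

definition affine_map ::
    "(nat \<Rightarrow> nat \<Rightarrow> real^'d^'d) \<Rightarrow> (nat list \<Rightarrow> real^'d) \<Rightarrow> nat list \<Rightarrow> real^'d \<Rightarrow> real^'d" where
  "affine_map T \<omega> u = foldr (\<circ>) (map (affine_step T \<omega> u) [1..<Suc (length u)]) id"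

locale nonautonomous_affine_system =
  fixes n :: "nat \<Rightarrow> nat"
    and T :: "nat \<Rightarrow> nat \<Rightarrow> real^'d^'d"
    and J :: "(real^'d) set"
    and Jw :: "nat list \<Rightarrow> (real^'d) set"
  assumes two_le_n: "1 \<le> k \<Longrightarrow> 2 \<le> n k"
    and compact_J: "compact J"
    and interior_J: "interior J \<noteq> {}"
    and onorm_T: "1 \<le> k \<Longrightarrow> j \<in> {1..n k} \<Longrightarrow> onorm (\<lambda>x. T k j *v x) < 1"
    and closed_Jw: "u \<in> fin_words n \<Longrightarrow> closed (Jw u)"
    and Jw_subset_J: "u \<in> fin_words n \<Longrightarrow> Jw u \<subseteq> J"
    and Jw_Nil: "Jw [] = J"
    and Jw_nested: "1 \<le> k \<Longrightarrow> u \<in> words n (k - 1) \<Longrightarrow> j \<in> {1..n k} \<Longrightarrow> Jw (u @ [j]) \<subseteq> Jw u"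
    and Jw_affine: "\<exists>\<omega>. \<forall>u\<in>fin_words n. Jw u = affine_map T \<omega> u ` J"
    and diameter_Jw: "(\<lambda>k. Max ((\<lambda>u. diameter (Jw u)) ` words n k)) \<longlonglongrightarrow> 0"

definition nonautonomous_affine_set ::
    "(nat \<Rightarrow> nat) \<Rightarrow> (nat list \<Rightarrow> (real^'d) set) \<Rightarrow> (real^'d) set" where
  "nonautonomous_affine_set n Jw = (\<Inter>k\<in>{1..}. \<Union>u\<in>words n k. Jw u)"

definition alpha_plus :: "(nat \<Rightarrow> nat) \<Rightarrow> (nat \<Rightarrow> nat \<Rightarrow> real^'d^'d) \<Rightarrow> real" where
  "alpha_plus n T = (SUP (k, i)\<in>(SIGMA k:{1..}. {1..n k}). sing_val 1 (T k i))"

definition alpha_minus :: "(nat \<Rightarrow> nat) \<Rightarrow> (nat \<Rightarrow> nat \<Rightarrow> real^'d^'d) \<Rightarrow> real" where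
  "alpha_minus n T = (INF (k, i)\<in>(SIGMA k:{1..}. {1..n k}). sing_val CARD('d) (T k i))"

end

theory Submission
  imports Defs
begin

text \<open>
  If \<open>A\<close> has right singular vectors \<open>v\<^sub>i\<close>, the image under \<open>A\<close> of a ball of radius \<open>R\<close> lies in the
  parallelepiped spanned by the vectors \<open>A v\<^sub>i\<close>, of lengths \<open>\<alpha>\<^sub>i\<close>.  With \<open>m - 1 < s \<le> m\<close> it is covered
  by at most \<open>2\<^sup>d \<alpha>\<^sub>1 \<dots> \<alpha>\<^sub>m\<^sub>-\<^sub>1 / \<alpha>\<^sub>m\<^sup>m\<^sup>-\<^sup>1\<close> pieces of diameter at most \<open>2 R d \<alpha>\<^sub>m\<close>, so the \<open>s\<close>-powers of
  their diameters sum to at most a constant times \<open>\<phi>\<^sup>s(A)\<close>.  A cover of the symbolic space by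
  cylinders gives a cover of the affine set by the corresponding sets \<open>J\<^sub>u\<close>, hence one by such
  pieces.  The pieces are automatically small, as \<open>\<alpha>\<^sub>m\<^sup>s \<le> \<phi>\<^sup>s\<close> is at most the total sum.
\<close>

section \<open>Singular values\<close>

lemma symmetric_has_eigenvector_orthogonal:
  fixes f :: "'a::euclidean_space \<Rightarrow> 'a"
  assumes lin: "linear f" and sym: "\<And>x y. f x \<bullet> y = x \<bullet> f y"
    and eig: "\<And>b. b \<in> B \<Longrightarrow> \<exists>c. f b = c *\<^sub>R b"
    and "span B \<noteq> UNIV"
  shows "\<exists>v c. norm v = 1 \<and> (\<forall>b\<in>B. b \<bullet> v = 0) \<and> f v = c *\<^sub>R v"
proof -
  \<comment> \<open>The orthogonal complement of \<open>B\<close>. As \<open>f\<close> is symmetric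
    and \<open>B\<close> consists of eigenvectors, \<open>f\<close> maps it into itself, so the
    variational search for an eigenvector can be run inside it.\<close>
  define S where "S = {y. \<forall>b\<in>B. b \<bullet> y = 0}"
  have S_add: "x + r *\<^sub>R y \<in> S" if "x \<in> S" "y \<in> S" for x y r
    using that by (simp add: S_def inner_add_right)
  have S_scale: "r *\<^sub>R y \<in> S" if "y \<in> S" for y r
    using that by (simp add: S_def)
  have S_f: "f y \<in> S" if "y \<in> S" for y
    unfolding S_def
  proof clarify
    fix b assume "b \<in> B"
    then obtain c where "f b = c *\<^sub>R b" using eig by blast
    then have "b \<bullet> f y = c * (b \<bullet> y)" by (simp flip: sym)
    then show "b \<bullet> f y = 0" using that \<open>b \<in> B\<close> by (simp add: S_def)
  qed
  obtain x where x: "x \<noteq> 0" "\<And>y. y \<in> span B \<Longrightarrow> orthogonal x y"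
    using orthogonal_to_subspace_exists_gen[of B UNIV] \<open>span B \<noteq> UNIV\<close> by auto
  have "x \<in> S"
    using x(2) by (auto simp: S_def orthogonal_def inner_commute span_base)
  have "closed S"
  proof -
    have "S = (\<Inter>b\<in>B. {y. b \<bullet> y = 0})" by (auto simp: S_def)
    then show ?thesis by (auto intro!: closed_INT closed_hyperplane)
  qed
  txt \<open>A maximiser of the quadratic form of \<open>f\<close> on the unit sphere of \<open>S\<close> is an eigenvector.\<close>
  then have "compact (sphere 0 1 \<inter> S)"
    by (intro compact_Int_closed compact_sphere)
  moreover have "(1 / norm x) *\<^sub>R x \<in> sphere 0 1 \<inter> S"
    using x(1) \<open>x \<in> S\<close> S_scale by simp
  then have "sphere 0 1 \<inter> S \<noteq> {}" by blast
  moreover have "continuous_on (sphere 0 1 \<inter> S) (\<lambda>y. f y \<bullet> y)"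
    using lin by (intro continuous_on_inner continuous_on_id linear_continuous_on)
      (simp add: linear_conv_bounded_linear)
  ultimately have "\<exists>v\<in>sphere 0 1 \<inter> S. \<forall>y\<in>sphere 0 1 \<inter> S. f y \<bullet> y \<le> f v \<bullet> v"
    by (rule continuous_attains_sup)
  then obtain v where v: "v \<in> sphere 0 1 \<inter> S"
      and max: "\<And>y. y \<in> sphere 0 1 \<inter> S \<Longrightarrow> f y \<bullet> y \<le> f v \<bullet> v"
    by blast
  define c where "c = f v \<bullet> v"
  have nv: "norm v = 1" "v \<in> S" "v \<bullet> v = 1" using v by (auto simp: norm_eq_1)
  \<comment> \<open>Homogeneity extends the maximality of \<open>v\<close> from unit vectors to all
    of \<open>S\<close>.\<close>
  have le: "f y \<bullet> y \<le> c * (y \<bullet> y)" if "y \<in> S" for y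
  proof (cases "y = 0")
    case False
    have "f ((1 / norm y) *\<^sub>R y) \<bullet> ((1 / norm y) *\<^sub>R y) \<le> c"
      unfolding c_def using False that by (intro max) (simp add: S_scale)
    then have "(f y \<bullet> y) / (norm y)\<^sup>2 \<le> c"
      by (simp add: linear_cmul[OF lin] power2_eq_square)
    then show ?thesis
      using False by (simp add: field_simps power2_norm_eq_inner)
  qed (simp add: linear_0[OF lin])
  \<comment> \<open>The defect of the eigenvector equation. Moving from \<open>v\<close> by
    \<open>t *\<^sub>R z\<close> changes the deficit
    \<open>c * (y \<bullet> y) - f y \<bullet> y\<close>, which is 0 at \<open>v\<close> and
    nonnegative on \<open>S\<close>, by \<open>2 * t * (z \<bullet> z)\<close> to first order; this
    has to vanish.\<close>
  define z where "z = c *\<^sub>R v - f v"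
  have zS: "z \<in> S"
    using S_add[of "c *\<^sub>R v" "f v" "-1"] nv S_f S_scale by (simp add: z_def)
  define q where "q = c * (z \<bullet> z) - f z \<bullet> z"
  have ineq: "0 \<le> 2 * t * (z \<bullet> z) + t\<^sup>2 * q" for t
  proof -
    have "f (v + t *\<^sub>R z) \<bullet> (v + t *\<^sub>R z) \<le> c * ((v + t *\<^sub>R z) \<bullet> (v + t *\<^sub>R z))"
      using le S_add nv zS by blast
    also have "f (v + t *\<^sub>R z) \<bullet> (v + t *\<^sub>R z) = c + 2 * t * (f v \<bullet> z) + t\<^sup>2 * (f z \<bullet> z)"
      using sym[of z v]
      by (simp add: linear_add[OF lin] linear_cmul[OF lin] inner_add_left inner_add_right c_def
          inner_commute power2_eq_square algebra_simps)
    also have "c * ((v + t *\<^sub>R z) \<bullet> (v + t *\<^sub>R z)) = c + 2 * t * (c * (v \<bullet> z)) + t\<^sup>2 * (c * (z \<bullet> z))"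
      using nv by (simp add: inner_add_left inner_add_right inner_commute power2_eq_square algebra_simps)
    finally have "0 \<le> 2 * t * (c * (v \<bullet> z) - f v \<bullet> z) + t\<^sup>2 * q"
      unfolding q_def right_diff_distrib by linarith
    also have "c * (v \<bullet> z) - f v \<bullet> z = z \<bullet> z"
      by (subst (3) z_def) (simp add: inner_diff_left)
    finally show ?thesis .
  qed
  have "z \<bullet> z = 0"
  proof (rule ccontr)
    assume "z \<bullet> z \<noteq> 0"
    then have pos: "z \<bullet> z > 0" by (simp add: inner_ge_zero less_le)
    \<comment> \<open>Negative, and so small that the second-order term cannot outweigh the
      first-order one.\<close>
    define t where "t = - (z \<bullet> z) / (\<bar>q\<bar> + 1)"
    have "t < 0" using pos by (simp add: t_def divide_neg_pos)
    moreover have "0 \<le> t * (2 * (z \<bullet> z) + t * q)"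
      using ineq[of t] by (simp add: power2_eq_square algebra_simps)
    ultimately have "2 * (z \<bullet> z) + t * q \<le> 0"
      by (simp add: zero_le_mult_iff)
    moreover have "\<bar>t * q\<bar> \<le> z \<bullet> z"
      using pos by (simp add: t_def abs_mult field_simps)
    ultimately show False using pos by linarith
  qed
  then have "f v = c *\<^sub>R v" by (simp add: z_def)
  then show ?thesis using nv unfolding S_def by blast
qed

text \<open>Fewer than \<open>DIM('a)\<close> vectors do not span, so an orthonormal set of
  eigenvectors can be enlarged one vector at a time.\<close>

lemma symmetric_orthonormal_eigenvectors:
  fixes f :: "'a::euclidean_space \<Rightarrow> 'a"
  assumes lin: "linear f" and sym: "\<And>x y. f x \<bullet> y = x \<bullet> f y"
    and "k \<le> DIM('a)"
  shows "\<exists>B. finite B \<and> card B = k \<and> (\<forall>b\<in>B. \<forall>b'\<in>B. b \<bullet> b' = (if b = b' then 1 else 0)) \<and>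
           (\<forall>b\<in>B. \<exists>c. f b = c *\<^sub>R b)"
  using \<open>k \<le> DIM('a)\<close>
proof (induction k)
  case 0
  then show ?case by (intro exI[of _ "{}"]) auto
next
  case (Suc k)
  then obtain B where B: "finite B" "card B = k"
      "\<forall>b\<in>B. \<forall>b'\<in>B. b \<bullet> b' = (if b = b' then 1 else 0)" "\<forall>b\<in>B. \<exists>c. f b = c *\<^sub>R b"
    by (meson Suc_leD)
  have "dim B < DIM('a)"
    using dim_le_card'[OF B(1)] B(2) Suc.prems by linarith
  then have "span B \<noteq> UNIV"
    by (metis dim_UNIV dim_span nless_le)
  then obtain v c where v: "norm v = 1" "\<forall>b\<in>B. b \<bullet> v = 0" "f v = c *\<^sub>R v"
    using symmetric_has_eigenvector_orthogonal[OF lin sym] B(4) by metis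
  have "v \<bullet> v = 1" using v(1) by (simp add: norm_eq_1)
  then have "v \<notin> B" using v(2) by force
  then show ?case
    using B v \<open>v \<bullet> v = 1\<close>
    by (intro exI[of _ "insert v B"]) (auto simp: inner_commute)
qed

text \<open>Indexing the basis by the type \<open>'d\<close> itself makes its vectors usable as the
  columns of a square matrix.\<close>

lemma matrix_orthonormal_eigenbasis:
  fixes S :: "real^'d^'d"
  assumes "transpose S = S"
  shows "\<exists>v :: 'd \<Rightarrow> real^'d. (\<forall>i j. v i \<bullet> v j = (if i = j then 1 else 0)) \<and>
           (\<forall>i. \<exists>c. S *v v i = c *\<^sub>R v i)"
proof -
  have "linear ((*v) S)" by simp
  moreover have "(S *v x) \<bullet> y = x \<bullet> (S *v y)" for x y
    using assms by (metis dot_lmul_matrix vector_transpose_matrix transpose_matrix_vector)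
  ultimately obtain B where B: "finite B" "card B = CARD('d)"
      "\<forall>b\<in>B. \<forall>b'\<in>B. b \<bullet> b' = (if b = b' then 1 else 0)" "\<forall>b\<in>B. \<exists>c. S *v b = c *\<^sub>R b"
    using symmetric_orthonormal_eigenvectors[of "(*v) S" "CARD('d)"] by auto
  obtain v :: "'d \<Rightarrow> real^'d" where v: "bij_betw v UNIV B"
    using B(1,2) finite_same_card_bij[of "UNIV :: 'd set" B] by auto
  then have vB: "v i \<in> B" "v i = v j \<longleftrightarrow> i = j" for i j
    by (auto simp: bij_betw_def inj_eq)
  show ?thesis
    by (rule exI[of _ v]) (use B vB in auto)
qed

text \<open>The vectors are an orthonormal eigenbasis of \<open>transpose A ** A\<close>. The
  eigenvalue of \<open>v i\<close> is the squared length of \<open>A *v v i\<close>, and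
  diagonalisation factors the characteristic polynomial.\<close>

lemma right_singular_basis:
  fixes A :: "real^'d^'d"
  shows "\<exists>v :: 'd \<Rightarrow> real^'d. (\<forall>x. x = (\<Sum>i\<in>UNIV. (v i \<bullet> x) *\<^sub>R v i)) \<and> (\<forall>i. norm (v i) = 1) \<and>
    (\<forall>x. det (mat x - transpose A ** A) = (\<Prod>i\<in>UNIV. x - (norm (A *v v i))\<^sup>2))"
proof -
  let ?S = "transpose A ** A"
  have "transpose ?S = ?S" by (simp add: matrix_transpose_mul)
  then obtain v :: "'d \<Rightarrow> real^'d" where v: "\<And>i j. v i \<bullet> v j = (if i = j then 1 else 0)"
      and ev: "\<And>i. \<exists>c. ?S *v v i = c *\<^sub>R v i"
    using matrix_orthonormal_eigenbasis by metis
  define \<sigma> where "\<sigma> i = norm (A *v v i)" for i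
  have Sv: "?S *v v i = (\<sigma> i)\<^sup>2 *\<^sub>R v i" for i
  proof -
    obtain c where c: "?S *v v i = c *\<^sub>R v i" using ev by blast
    have "c = (?S *v v i) \<bullet> v i" by (simp add: c v)
    also have "\<dots> = (\<sigma> i)\<^sup>2"
      unfolding \<sigma>_def power2_norm_eq_inner
      by (metis dot_lmul_matrix matrix_vector_mul_assoc transpose_matrix_vector vector_transpose_matrix)
    finally show ?thesis using c by simp
  qed
  \<comment> \<open>The columns of \<open>P\<close> are the \<open>v j\<close>. Of the two relations
    making \<open>P\<close> orthogonal, one is orthonormality and the other gives the expansion of
    every vector in the basis.\<close>
  define P :: "real^'d^'d" where "P = (\<chi> i j. v j $ i)"
  define D :: "real \<Rightarrow> real^'d^'d" where "D x = (\<chi> i j. if i = j then x - (\<sigma> i)\<^sup>2 else 0)" for x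
  have PtP: "transpose P ** P = mat 1"
    by (simp add: vec_eq_iff matrix_matrix_mult_def transpose_def P_def mat_def
        v[unfolded inner_vec_def, simplified])
  then have PPt: "P ** transpose P = mat 1"
    by (simp add: matrix_left_right_inverse)
  have "(mat x - ?S) ** P = P ** D x" for x
  proof -
    have "((mat x - ?S) ** P) $ i $ j = (P ** D x) $ i $ j" for i j
    proof -
      have "((mat x - ?S) ** P) $ i $ j = ((mat x - ?S) *v v j) $ i"
        by (simp add: matrix_matrix_mult_def matrix_vector_mult_def P_def)
      also have "(mat x - ?S) *v v j = x *\<^sub>R v j - ?S *v v j"
        by (simp add: matrix_vector_mult_diff_rdistrib vec_eq_iff)
          (simp add: matrix_vector_mult_def mat_def if_distrib[of "\<lambda>a. a * _"] cong: if_cong)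
      also have "\<dots> $ i = (P ** D x) $ i $ j"
        unfolding Sv by (simp add: matrix_matrix_mult_def P_def D_def algebra_simps if_distrib[of "\<lambda>a. _ * a"]
            cong: if_cong)
      finally show ?thesis .
    qed
    then show ?thesis by (simp add: vec_eq_iff)
  qed
  then have "det (mat x - ?S) * det P = det P * det (D x)" for x
    by (metis det_mul)
  moreover have "det P \<noteq> 0"
    by (metis PtP det_I det_mul mult_zero_right zero_neq_one)
  ultimately have "det (mat x - ?S) = det (D x)" for x by (simp add: mult.commute)
  then have "det (mat x - ?S) = (\<Prod>i\<in>UNIV. x - (\<sigma> i)\<^sup>2)" for x
    using det_diagonal[of "D x"] by (simp add: D_def)
  moreover have "x = (\<Sum>i\<in>UNIV. (v i \<bullet> x) *\<^sub>R v i)" for x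
  proof -
    have "x = P *v (transpose P *v x)"
      unfolding matrix_vector_mul_assoc PPt by simp
    also have "\<dots> = (\<Sum>i\<in>UNIV. (v i \<bullet> x) *\<^sub>R v i)"
      by (simp add: vec_eq_iff matrix_vector_mult_def transpose_def P_def inner_vec_def mult.commute)
    finally show ?thesis .
  qed
  moreover have "norm (v i) = 1" for i by (simp add: norm_eq_1 v)
  ultimately show ?thesis unfolding \<sigma>_def by blast
qed

text \<open>Justifies the definite description in \<open>singular_values\<close>. The head of either
  list is the square root of the largest root of the common polynomial, so the heads agree; cancel
  their factors and induct.\<close>

lemma sorted_square_roots_unique:
  fixes as bs :: "real list"
  assumes "sorted_wrt (\<ge>) as" "\<forall>a\<in>set as. 0 \<le> a"
    and "sorted_wrt (\<ge>) bs" "\<forall>b\<in>set bs. 0 \<le> b"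
    and "\<And>x. (\<Prod>a\<leftarrow>as. x - a\<^sup>2) = (\<Prod>b\<leftarrow>bs. x - b\<^sup>2)"
  shows "as = bs"
proof -
  define p :: "real list \<Rightarrow> real poly" where "p cs = (\<Prod>c\<leftarrow>cs. [:- (c\<^sup>2), 1:])" for cs
  have p_Nil: "p [] = 1" and p_Cons: "p (c # cs) = [:- (c\<^sup>2), 1:] * p cs" for c cs
    by (simp_all add: p_def)
  have ev: "poly (p cs) x = (\<Prod>c\<leftarrow>cs. x - c\<^sup>2)" for cs x
    by (induction cs) (auto simp: p_Nil p_Cons algebra_simps)
  have root: "poly (p cs) x = 0 \<longleftrightarrow> (\<exists>c\<in>set cs. x = c\<^sup>2)" for cs x
    by (induction cs) (auto simp: p_Nil p_Cons)
  \<comment> \<open>Working with polynomials rather than values lets the common linear factor be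
    cancelled even though it vanishes at its root.\<close>
  have "p as = p bs"
    using assms(5) by (simp add: poly_eq_poly_eq_iff[symmetric] fun_eq_iff ev)
  with assms(1-4) show ?thesis
  proof (induction as arbitrary: bs)
    case Nil
    then have "\<not> (\<exists>b\<in>set bs. x = b\<^sup>2)" for x
      using root[of bs x] by (simp add: p_Nil)
    then show ?case by (cases bs) auto
  next
    case (Cons a as)
    have "\<exists>b\<in>set bs. a\<^sup>2 = b\<^sup>2"
      using root[of "a # as" "a\<^sup>2"] root[of bs "a\<^sup>2"] Cons.prems(5) by simp
    then obtain b bs' where bs: "bs = b # bs'" by (cases bs) auto
    note prems = Cons.prems[unfolded bs]
    obtain b' where "b' \<in> set (b # bs')" "a\<^sup>2 = b'\<^sup>2"
      using \<open>\<exists>b\<in>set bs. a\<^sup>2 = b\<^sup>2\<close> bs by blast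
    then have "a \<le> b" using prems(2-4) by (auto simp: power2_eq_iff_nonneg)
    obtain a' where "a' \<in> set (a # as)" "b\<^sup>2 = a'\<^sup>2"
      using root[of "a # as" "b\<^sup>2"] root[of "b # bs'" "b\<^sup>2"] prems(5) by auto
    then have "b \<le> a" using prems(1,2,4) by (auto simp: power2_eq_iff_nonneg)
    with \<open>a \<le> b\<close> have "a = b" by simp
    then have "p as = p bs'" using prems(5) by (simp add: p_Cons del: mult_pCons_left)
    then show ?case using Cons.IH[of bs'] prems \<open>a = b\<close> bs by simp
  qed
qed

lemma singular_values_eq:
  fixes A :: "real^'d^'d"
  assumes "sorted_wrt (\<ge>) \<sigma>" "\<forall>a\<in>set \<sigma>. 0 \<le> a"
    and "\<And>x. det (mat x - transpose A ** A) = (\<Prod>a\<leftarrow>\<sigma>. x - a\<^sup>2)"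
  shows "singular_values A = \<sigma>"
  unfolding singular_values_def
proof (rule the_equality)
  show "\<tau> = \<sigma>" if "sorted_wrt (\<ge>) \<tau> \<and> (\<forall>a\<in>set \<tau>. 0 \<le> a) \<and>
      (\<forall>x. det (mat x - transpose A ** A) = (\<Prod>a\<leftarrow>\<tau>. x - a\<^sup>2))" for \<tau>
    by (rule sorted_square_roots_unique) (use that assms in auto)
qed (use assms in auto)

text \<open>The list \<open>xs\<close> orders indices, not values, so each singular value stays
  attached to its singular vector, also when values coincide.\<close>

lemma singular_values_conv_basis:
  fixes A :: "real^'d^'d"
  shows "\<exists>(v :: 'd \<Rightarrow> real^'d) xs. (\<forall>x. x = (\<Sum>i\<in>UNIV. (v i \<bullet> x) *\<^sub>R v i)) \<and> (\<forall>i. norm (v i) = 1) \<and>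
    distinct xs \<and> set xs = UNIV \<and> singular_values A = map (\<lambda>i. norm (A *v v i)) xs \<and>
    sorted_wrt (\<ge>) (map (\<lambda>i. norm (A *v v i)) xs)"
proof -
  obtain v :: "'d \<Rightarrow> real^'d" where v: "\<And>x. x = (\<Sum>i\<in>UNIV. (v i \<bullet> x) *\<^sub>R v i)"
    "\<And>i. norm (v i) = 1"
    "\<And>x. det (mat x - transpose A ** A) = (\<Prod>i\<in>UNIV. x - (norm (A *v v i))\<^sup>2)"
    using right_singular_basis[of A] by blast
  define \<sigma> where "\<sigma> i = norm (A *v v i)" for i
  obtain ys :: "'d list" where ys: "set ys = UNIV" "distinct ys"
    using finite_distinct_list[of "UNIV :: 'd set"] by auto
  define xs where "xs = rev (sort_key \<sigma> ys)"
  have xs: "distinct xs" "set xs = UNIV" using ys by (simp_all add: xs_def)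
  have sorted: "sorted_wrt (\<ge>) (map \<sigma> xs)"
    using sorted_sort_key[of \<sigma> ys] by (simp add: xs_def sorted_wrt_rev flip: rev_map)
  have "singular_values A = map \<sigma> xs"
  proof (rule singular_values_eq[OF sorted])
    show "det (mat x - transpose A ** A) = (\<Prod>a\<leftarrow>map \<sigma> xs. x - a\<^sup>2)" for x
      using prod.distinct_set_conv_list[OF xs(1), of "\<lambda>i. x - (\<sigma> i)\<^sup>2"]
      by (simp add: v(3) xs(2) \<sigma>_def o_def)
  qed (simp add: \<sigma>_def)
  then show ?thesis
    using v xs sorted unfolding \<sigma>_def by blast
qed

section \<open>Hausdorff measure and covers\<close>

lemma interval_grid:
  fixes y h :: real
  assumes "0 < h" "0 < N" "\<bar>y\<bar> \<le> real N * h"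
  shows "\<exists>k<N. \<bar>y - (2 * real k + 1 - real N) * h\<bar> \<le> h"
proof -
  \<comment> \<open>Distance of \<open>y\<close> from the left end \<open>- N * h\<close> in units
    of the cell length \<open>2 * h\<close>; its integer part is the index of the cell.\<close>
  define t where "t = (y / h + real N) / 2"
  have "2 * t - real N = y / h"
    by (simp add: t_def field_simps)
  then have y: "y = (2 * t - real N) * h"
    using assms by simp
  have "\<bar>y / h\<bar> \<le> real N"
    using assms by (simp add: divide_le_eq)
  then have t: "0 \<le> t" "t \<le> real N"
    unfolding t_def abs_le_iff by simp_all
  have "\<exists>k<N. real k \<le> t \<and> t \<le> real k + 1"
  proof (cases "t = real N")
    \<comment> \<open>At the right end the integer part would be \<open>N\<close>, which is no cell;
      the point belongs to the last one.\<close>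
    case True
    then show ?thesis using assms by (intro exI[of _ "N - 1"]) (auto simp: of_nat_diff)
  next
    case False
    then have "nat \<lfloor>t\<rfloor> < N" using t by linarith
    moreover have "real (nat \<lfloor>t\<rfloor>) \<le> t \<and> t \<le> real (nat \<lfloor>t\<rfloor>) + 1"
      using t by linarith
    ultimately show ?thesis by blast
  qed
  then obtain k where k: "k < N" "real k \<le> t" "t \<le> real k + 1" by blast
  have "y - (2 * real k + 1 - real N) * h = (2 * t - 2 * real k - 1) * h"
    by (simp add: y algebra_simps)
  moreover have "\<bar>2 * t - 2 * real k - 1\<bar> * h \<le> 1 * h"
    using assms k by (intro mult_right_mono) linarith+
  ultimately have "\<bar>y - (2 * real k + 1 - real N) * h\<bar> \<le> h"
    using assms by (simp add: abs_mult)
  then show ?thesis using k by blast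
qed

text \<open>Cut the range of the \<open>i\<close>-th coordinate into \<open>N i\<close> cells; each
  choice of cells gives one piece. Two points of a piece differ by at most
  \<open>2 * R / N i\<close> in coordinate \<open>i\<close>, and the triangle inequality bounds the
  diameter.\<close>

lemma parallelepiped_cover:
  fixes w :: "'i::finite \<Rightarrow> 'a::real_normed_vector"
  assumes "0 < R" "\<And>i. 0 < N i"
  shows "\<exists>P. finite P \<and> card P \<le> (\<Prod>i\<in>UNIV. N i) \<and>
    {b + (\<Sum>i\<in>UNIV. y i *\<^sub>R w i) | y. \<forall>i. \<bar>y i\<bar> \<le> R} \<subseteq> \<Union>P \<and>
    (\<forall>U\<in>P. bounded U \<and> diameter U \<le> (\<Sum>i\<in>UNIV. 2 * R / real (N i) * norm (w i)))"
proof -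
  define h where "h i = R / real (N i)" for i
  have h: "0 < h i" "real (N i) * h i = R" for i
    using assms by (simp_all add: h_def less_imp_neq[symmetric])
  define Q where "Q g = {b + (\<Sum>i\<in>UNIV. y i *\<^sub>R w i) | y.
      \<forall>i. \<bar>y i - (2 * real (g i) + 1 - real (N i)) * h i\<bar> \<le> h i}" for g :: "'i \<Rightarrow> nat"
  define G where "G = PiE UNIV (\<lambda>i. {..<N i})"
  let ?d = "\<Sum>i\<in>UNIV. 2 * R / real (N i) * norm (w i)"
  have "finite G" by (simp add: G_def finite_PiE)
  moreover have "card (Q ` G) \<le> (\<Prod>i\<in>UNIV. N i)"
    using card_image_le[OF \<open>finite G\<close>, of Q] by (simp add: G_def card_PiE)
  moreover have "{b + (\<Sum>i\<in>UNIV. y i *\<^sub>R w i) | y. \<forall>i. \<bar>y i\<bar> \<le> R} \<subseteq> \<Union>(Q ` G)"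
  proof clarify
    fix y :: "'i \<Rightarrow> real" assume "\<forall>i. \<bar>y i\<bar> \<le> R"
    then have "\<exists>k<N i. \<bar>y i - (2 * real k + 1 - real (N i)) * h i\<bar> \<le> h i" for i
      using interval_grid[OF h(1) assms(2)] h(2) by simp
    then obtain g where "\<And>i. g i < N i"
        "\<And>i. \<bar>y i - (2 * real (g i) + 1 - real (N i)) * h i\<bar> \<le> h i"
      by metis
    then have "g \<in> G" "b + (\<Sum>i\<in>UNIV. y i *\<^sub>R w i) \<in> Q g" by (auto simp: G_def Q_def)
    then show "b + (\<Sum>i\<in>UNIV. y i *\<^sub>R w i) \<in> \<Union>(Q ` G)" by blast
  qed
  moreover have "bounded U \<and> diameter U \<le> ?d" if "U \<in> Q ` G" for U
  proof -
    obtain g where g: "U = Q g" using \<open>U \<in> Q ` G\<close> by blast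
    have le: "norm (p - q) \<le> ?d" if "p \<in> U" "q \<in> U" for p q
    proof -
      obtain y where y: "p = b + (\<Sum>i\<in>UNIV. y i *\<^sub>R w i)"
        "\<And>i. \<bar>y i - (2 * real (g i) + 1 - real (N i)) * h i\<bar> \<le> h i"
        using \<open>p \<in> U\<close> unfolding g Q_def by blast
      obtain z where z: "q = b + (\<Sum>i\<in>UNIV. z i *\<^sub>R w i)"
        "\<And>i. \<bar>z i - (2 * real (g i) + 1 - real (N i)) * h i\<bar> \<le> h i"
        using \<open>q \<in> U\<close> unfolding g Q_def by blast
      have "\<bar>y i - z i\<bar> \<le> 2 * h i" for i
        using y(2)[of i] z(2)[of i] by (simp only: abs_le_iff) linarith
      then have "\<bar>y i - z i\<bar> \<le> 2 * R / real (N i)" for i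
        by (simp add: h_def)
      moreover have "p - q = (\<Sum>i\<in>UNIV. (y i - z i) *\<^sub>R w i)"
        by (simp add: y z sum_subtractf scaleR_diff_left)
      ultimately show ?thesis
        by (simp only:) (intro sum_norm_le, simp only: norm_scaleR, intro mult_right_mono, auto)
    qed
    have "0 \<le> ?d" using assms by (intro sum_nonneg) (simp add: less_imp_le)
    then have "diameter U \<le> ?d" using le by (intro diameter_le) auto
    moreover have "bounded U" using le unfolding bounded_two_points dist_norm by blast
    ultimately show ?thesis by blast
  qed
  ultimately show ?thesis by (intro exI[of _ "Q ` G"]) blast
qed

text \<open>A sequence of finite families is flattened into one sequence by pairing naturals. Each
  block is padded with empty sets, whose gauge is 0 for every exponent.\<close>

lemma hausdorff_premeasure_le_suminf:
  fixes P :: "nat \<Rightarrow> 'a::metric_space set set"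
  assumes cov: "A \<subseteq> (\<Union>k. \<Union>(P k))" and fin: "\<And>k. finite (P k)" and "0 \<le> \<delta>"
    and P: "\<And>k U. U \<in> P k \<Longrightarrow> bounded U \<and> diameter U \<le> \<delta>"
  shows "hausdorff_premeasure s \<delta> A \<le> (\<Sum>k. \<Sum>U\<in>P k. ennreal (hausdorff_gauge s U))"
proof -
  have "\<exists>h. bij_betw h {..<card (P k)} (P k)" for k
    using ex_bij_betw_nat_finite[OF fin[of k]] by (simp add: lessThan_atLeast0)
  then obtain f where f: "\<And>k. bij_betw (f k) {..<card (P k)} (P k)"
    by metis
  define V where "V = (\<lambda>(k, j). if j < card (P k) then f k j else {})"
  have V_sub: "V (k, j) \<in> P k \<or> V (k, j) = {}" for k j
    using bij_betwE[OF f] by (auto simp: V_def)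
  have "A \<subseteq> (\<Union>i. V (prod_decode i))"
  proof
    fix x assume "x \<in> A"
    then obtain k U where "x \<in> U" "U \<in> P k" using cov by blast
    have "U \<in> f k ` {..<card (P k)}"
      using \<open>U \<in> P k\<close> bij_betw_imp_surj_on[OF f[of k]] by simp
    then obtain j where "j < card (P k)" "U = f k j" by blast
    with \<open>x \<in> U\<close> have "x \<in> V (prod_decode (prod_encode (k, j)))" by (simp add: V_def)
    then show "x \<in> (\<Union>i. V (prod_decode i))" by blast
  qed
  moreover have "bounded (V (prod_decode i)) \<and> diameter (V (prod_decode i)) \<le> \<delta>" for i
  proof (cases "prod_decode i")
    case (Pair k j)
    then show ?thesis using V_sub[of k j] P[of "V (k, j)" k] \<open>0 \<le> \<delta>\<close> by auto
  qed
  ultimately have "hausdorff_premeasure s \<delta> A \<le> (\<Sum>i. ennreal (hausdorff_gauge s (V (prod_decode i))))"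
    unfolding hausdorff_premeasure_def by (intro Inf_lower) (auto intro!: exI[of _ "\<lambda>i. V (prod_decode i)"])
  also have "\<dots> = (\<Sum>k. \<Sum>U\<in>P k. ennreal (hausdorff_gauge s U))"
  proof (rule suminf_ennreal_2dimen[where f = "\<lambda>kj. ennreal (hausdorff_gauge s (V kj))"])
    fix k
    have "(\<Sum>U\<in>P k. ennreal (hausdorff_gauge s U))
        = (\<Sum>j<card (P k). ennreal (hausdorff_gauge s (V (k, j))))"
      using sum.reindex_bij_betw[OF f, of "\<lambda>U. ennreal (hausdorff_gauge s U)" k]
      by (simp add: V_def)
    also have "\<dots> = (\<Sum>j. ennreal (hausdorff_gauge s (V (k, j))))"
      by (rule suminf_finite[symmetric]) (auto simp: V_def hausdorff_gauge_def)
    finally show "(\<Sum>U\<in>P k. ennreal (hausdorff_gauge s U)) = (\<Sum>j. ennreal (hausdorff_gauge s (V (k, j))))" .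
  qed
  finally show ?thesis .
qed

text \<open>Carries the sequential bound over to index sets such as sets of finite words; numbers
  that code no element of \<open>C\<close> get the empty family.\<close>

lemma hausdorff_premeasure_le_infsum:
  fixes P :: "'i::countable \<Rightarrow> 'a::metric_space set set"
  assumes cov: "A \<subseteq> (\<Union>u\<in>C. \<Union>(P u))" and fin: "\<And>u. u \<in> C \<Longrightarrow> finite (P u)" and "0 \<le> \<delta>"
    and P: "\<And>u U. u \<in> C \<Longrightarrow> U \<in> P u \<Longrightarrow> bounded U \<and> diameter U \<le> \<delta>"
  shows "hausdorff_premeasure s \<delta> A \<le> (\<Sum>\<^sub>\<infinity>u\<in>C. \<Sum>U\<in>P u. ennreal (hausdorff_gauge s U))"
proof -
  let ?g = "\<lambda>u. \<Sum>U\<in>P u. ennreal (hausdorff_gauge s U)"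
  define Q where "Q k = (if k \<in> to_nat ` C then P (from_nat k) else {})" for k
  let ?h = "\<lambda>k. \<Sum>U\<in>Q k. ennreal (hausdorff_gauge s U)"
  have "hausdorff_premeasure s \<delta> A \<le> suminf ?h"
  proof (rule hausdorff_premeasure_le_suminf[OF _ _ \<open>0 \<le> \<delta>\<close>])
    show "A \<subseteq> (\<Union>k. \<Union>(Q k))"
    proof
      fix x assume "x \<in> A"
      then obtain u where "u \<in> C" "x \<in> \<Union>(P u)" using cov by blast
      then have "x \<in> \<Union>(Q (to_nat u))" by (simp add: Q_def)
      then show "x \<in> (\<Union>k. \<Union>(Q k))" by blast
    qed
  qed (use fin P in \<open>auto simp: Q_def split: if_splits\<close>)
  also have "suminf ?h = infsum ?h UNIV"
    by (rule sums_unique[symmetric], rule has_sum_imp_sums, rule has_sum_infsum)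
      (simp add: nonneg_summable_on_complete)
  also have "\<dots> = infsum ?h (to_nat ` C)"
    by (intro infsum_cong_neutral) (auto simp: Q_def)
  also have "\<dots> = infsum ?g C"
    by (subst infsum_reindex) (auto simp: Q_def intro!: infsum_cong)
  finally show ?thesis .
qed

lemma hausdorff_gauge_le:
  assumes "0 < s" "diameter U \<le> D" "bounded U"
  shows "hausdorff_gauge s U \<le> D powr s"
  using assms by (auto simp: hausdorff_gauge_def intro!: powr_mono2 diameter_ge_0)

lemma infsum_cmult_right_ennreal:
  fixes f :: "'i \<Rightarrow> ennreal"
  shows "(\<Sum>\<^sub>\<infinity>u\<in>C. c * f u) = c * (\<Sum>\<^sub>\<infinity>u\<in>C. f u)"
proof -
  have "(\<Sum>\<^sub>\<infinity>u\<in>C. c * f u) = (SUP F\<in>{F. finite F \<and> F \<subseteq> C}. c * sum f F)"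
    by (simp add: nonneg_infsum_complete sum_distrib_left)
  also have "\<dots> = c * (SUP F\<in>{F. finite F \<and> F \<subseteq> C}. sum f F)"
    by (rule SUP_mult_left_ennreal[symmetric])
  also have "\<dots> = c * (\<Sum>\<^sub>\<infinity>u\<in>C. f u)"
    by (simp add: nonneg_infsum_complete)
  finally show ?thesis .
qed

text \<open>A cube of side \<open>2 * R\<close> splits into \<open>N ^ d\<close> cells of diameter
  at most \<open>2 * R * d / N\<close>. For \<open>s > d\<close> their gauges sum to at most a
  multiple of \<open>N powr (d - s)\<close>, which tends to 0.\<close>

lemma hausdorff_dim_le_CARD:
  fixes E :: "(real^'d) set"
  assumes "bounded E"
  shows "hausdorff_dim E \<le> of_nat CARD('d)"
proof -
  obtain R where R: "0 < R" "\<And>x. x \<in> E \<Longrightarrow> norm x \<le> R"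
    using assms unfolding bounded_pos by blast
  let ?d = "real CARD('d)"
  have dpos: "?d > 0" by simp
  have "hausdorff_dim E \<le> ennreal s" if s: "s > ?d" for s
  proof -
    have pm: "hausdorff_premeasure s \<delta> E = 0" if "\<delta> > 0" for \<delta>
    proof -
      let ?b = "\<lambda>N::nat. (2 * R * ?d) powr s * real N powr (?d - s)"
      have ev: "hausdorff_premeasure s \<delta> E \<le> ennreal (?b N)"
        if N: "0 < N" "2 * R * ?d / \<delta> \<le> real N" for N
      proof -
        obtain P where P: "finite P" "card P \<le> (\<Prod>i\<in>(UNIV::'d set). N)"
          "{0 + (\<Sum>i\<in>UNIV. y i *\<^sub>R (axis i 1 :: real^'d)) | y. \<forall>i::'d. \<bar>y i\<bar> \<le> R} \<subseteq> \<Union>P"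
          and U: "\<forall>U\<in>P. bounded U \<and>
            diameter U \<le> (\<Sum>i\<in>UNIV. 2 * R / real N * norm (axis i (1::real) :: real^'d))"
          using parallelepiped_cover[OF R(1), of "\<lambda>_::'d. N" 0 "\<lambda>i. axis i 1 :: real^'d"] N(1)
          by blast
        have U: "bounded U" "diameter U \<le> 2 * R * ?d / real N" if "U \<in> P" for U
          using bspec[OF U that] by (simp_all add: mult_ac)
        have "E \<subseteq> \<Union>P"
        proof
          fix x assume "x \<in> E"
          then have "norm x \<le> R" using R by auto
          then have "\<bar>x $ i\<bar> \<le> R" for i using component_le_norm_cart order_trans by blast
          moreover have "x = 0 + (\<Sum>i\<in>UNIV. x $ i *\<^sub>R axis i 1)"
            using basis_expansion[of x] by (simp add: scalar_mult_eq_scaleR)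
          ultimately show "x \<in> \<Union>P" using P(3) by blast
        qed
        moreover have "2 * R * ?d / real N \<le> \<delta>"
          using N \<open>\<delta> > 0\<close> by (simp add: field_simps)
        ultimately have "hausdorff_premeasure s \<delta> E \<le>
            (\<Sum>\<^sub>\<infinity>u\<in>{0::nat}. \<Sum>U\<in>P. ennreal (hausdorff_gauge s U))"
          using P(1) U \<open>\<delta> > 0\<close> by (intro hausdorff_premeasure_le_infsum) (auto intro: order_trans)
        also have "\<dots> = (\<Sum>U\<in>P. ennreal (hausdorff_gauge s U))"
          by simp
        also have "\<dots> \<le> (\<Sum>U\<in>P. ennreal ((2 * R * ?d / real N) powr s))"
          using U s dpos by (intro sum_mono ennreal_leI hausdorff_gauge_le) linarith+
        also have "\<dots> = ennreal (real (card P) * (2 * R * ?d / real N) powr s)"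
          by (simp add: ennreal_mult ennreal_of_nat_eq_real_of_nat)
        also have "\<dots> \<le> ennreal (real N ^ CARD('d) * (2 * R * ?d / real N) powr s)"
          using P(2) by (intro ennreal_leI mult_right_mono) (simp_all flip: of_nat_power)
        also have "real N ^ CARD('d) * (2 * R * ?d / real N) powr s = ?b N"
          using N R by (simp add: powr_divide powr_diff powr_realpow)
        finally show ?thesis .
      qed
      have "?b \<longlonglongrightarrow> (2 * R * ?d) powr s * 0"
        using s by (intro tendsto_mult_left tendsto_neg_powr filterlim_real_sequentially) auto
      then have "(\<lambda>N. ennreal (?b N)) \<longlonglongrightarrow> ennreal 0"
        by (intro tendsto_ennrealI) simp
      moreover have "eventually (\<lambda>N. hausdorff_premeasure s \<delta> E \<le> ennreal (?b N)) sequentially"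
        using eventually_gt_at_top[of 0] eventually_ge_at_top[of "nat \<lceil>2 * R * ?d / \<delta>\<rceil>"]
        by eventually_elim (rule ev; linarith)
      ultimately have "hausdorff_premeasure s \<delta> E \<le> ennreal 0"
        by (rule tendsto_lowerbound) simp
      then show ?thesis by simp
    qed
    have "hausdorff_measure s E = 0"
      unfolding hausdorff_measure_def using pm by (auto intro!: antisym SUP_least)
    then show ?thesis
      using s dpos unfolding hausdorff_dim_def by (intro Inf_lower) (auto intro!: exI[of _ s])
  qed
  \<comment> \<open>Exponents exceeding \<open>d\<close> by arbitrarily little are
    admissible.\<close>
  then have "hausdorff_dim E \<le> ennreal ?d + ennreal e" if "e > 0" for e
    using that by (simp flip: ennreal_plus)
  then have "hausdorff_dim E \<le> ennreal ?d"
    by (rule ennreal_le_epsilon)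
  then show ?thesis by (simp only: ennreal_of_nat_eq_real_of_nat)
qed

text \<open>In the constant, the power of \<open>2 * R * d\<close> comes from the diameters and
  \<open>2 ^ d\<close> from rounding up the numbers of cells. The diameter bound is phrased through
  \<open>sing_val_fun s A\<close> so that a small sum over a cover of words forces small
  pieces.\<close>

lemma affine_image_cover:
  fixes A :: "real^'d^'d"
  assumes inv: "invertible A" and R: "0 < R" "\<And>x. x \<in> J \<Longrightarrow> norm x \<le> R"
    and s: "0 < s" "s \<le> real CARD('d)"
  shows "\<exists>P. finite P \<and> (\<lambda>x. A *v x + b) ` J \<subseteq> \<Union>P \<and> 0 < sing_val_fun s A \<and>
    (\<forall>U\<in>P. bounded U \<and> diameter U \<le> 2 * R * real CARD('d) * sing_val_fun s A powr (1 / s)) \<and>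
    (\<Sum>U\<in>P. ennreal (hausdorff_gauge s U)) \<le>
      ennreal ((2 * R * real CARD('d)) powr s * 2 ^ CARD('d)) * ennreal (sing_val_fun s A)"
proof -
  obtain v :: "'d \<Rightarrow> real^'d" and xs where
    v: "\<And>x. x = (\<Sum>i\<in>UNIV. (v i \<bullet> x) *\<^sub>R v i)" "\<And>i. norm (v i) = 1" and
    xs: "distinct xs" "set xs = UNIV" "singular_values A = map (\<lambda>i. norm (A *v v i)) xs"
    "sorted_wrt (\<ge>) (map (\<lambda>i. norm (A *v v i)) xs)"
    using singular_values_conv_basis[of A] by blast
  define \<sigma> where "\<sigma> i = norm (A *v v i)" for i
  let ?d = "CARD('d)"
  have len: "length xs = ?d" using distinct_card[OF xs(1)] xs(2) by simp
  have \<sigma>_pos: "0 < \<sigma> i" for i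
  proof -
    have "v i \<noteq> 0" using v(2)[of i] by auto
    then have "A *v v i \<noteq> 0"
      using inv matrix_left_invertible_ker unfolding invertible_def by blast
    then show ?thesis by (simp add: \<sigma>_def)
  qed
  \<comment> \<open>Here \<open>m - 1 < s \<le> m\<close>; \<open>r\<close> is the position of the
    \<open>m\<close>-th singular value in a list counted from 0, and \<open>a\<close> is that
    value.\<close>
  define m where "m = nat \<lceil>s\<rceil>"
  have m: "1 \<le> m" "m \<le> ?d" using s unfolding m_def by linarith+
  define r where "r = m - 1"
  have r: "m = Suc r" "r < ?d" using m by (simp_all add: r_def)
  define a where "a = \<sigma> (xs ! r)"
  have a: "0 < a" by (simp add: a_def \<sigma>_pos)
  have mono: "\<sigma> (xs ! l) \<le> \<sigma> (xs ! k)" if "k \<le> l" "l < ?d" for k l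
    using sorted_wrt_nth_less[OF xs(4), of k l] that len by (cases "k = l") (auto simp: \<sigma>_def)
  have sv: "sing_val (Suc k) A = \<sigma> (xs ! k)" if "k < ?d" for k
    using that len by (simp add: sing_val_def xs(3) \<sigma>_def)
  define p where "p = (\<Prod>k<r. \<sigma> (xs ! k))"
  have \<phi>: "sing_val_fun s A = p * a powr (s - real r)"
  proof -
    have "(\<Prod>i = 1..m - 1. sing_val i A) = (\<Prod>k<r. sing_val (Suc k) A)"
      by (simp add: r prod.atLeast1_atMost_eq)
    also have "\<dots> = p" unfolding p_def using r sv by (intro prod.cong) auto
    finally show ?thesis
      using s sv[of r] r(2) by (simp add: sing_val_fun_def Let_def m_def[symmetric] a_def r(1))
  qed
  \<comment> \<open>All \<open>r\<close> factors of \<open>p\<close> are at least \<open>a\<close>,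
    which lets \<open>sing_val_fun s A\<close> alone control the size \<open>a\<close> of the
    pieces.\<close>
  have "a ^ r \<le> p"
    using prod_mono[of "{..<r}" "\<lambda>_. a" "\<lambda>k. \<sigma> (xs ! k)"] mono[of _ r] r(2) a
    by (simp add: p_def a_def less_imp_le)
  have split: "a powr s = a ^ r * a powr (s - real r)"
    using a by (simp add: powr_diff powr_realpow)
  have a_le: "a powr s \<le> sing_val_fun s A"
    unfolding split \<phi> using \<open>a ^ r \<le> p\<close> by (intro mult_right_mono) auto
  moreover have "0 < a powr s" using a by simp
  ultimately have \<phi>_pos: "0 < sing_val_fun s A" by linarith
  have a_le': "a \<le> sing_val_fun s A powr (1 / s)"
    using powr_mono2[OF _ _ a_le, of "1 / s"] a s by (simp add: powr_powr)
  txt \<open>Cut the \<open>i\<close>-th axis of the ellipsoid into pieces of length comparable to \<open>a\<close>; axes no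
    longer than \<open>a\<close> stay in one piece.\<close>
  define N where "N i = nat \<lceil>\<sigma> i / a\<rceil>" for i
  have N_ge: "\<sigma> i / a \<le> real (N i)" for i
    using real_nat_ceiling_ge unfolding N_def .
  have N_pos: "0 < N i" for i
    using \<sigma>_pos[of i] a by (simp add: N_def)
  have "(\<Prod>i\<in>UNIV. real (N i)) = (\<Prod>k<?d. real (N (xs ! k)))"
    using prod.reindex_bij_betw[OF bij_betw_nth[OF xs(1) refl refl], of "\<lambda>i. real (N i)"]
    by (simp add: len xs(2))
  \<comment> \<open>For \<open>k < r\<close> the quotient is at least 1, so rounding up at most
    doubles it; on the other axes it is at most 1 and rounds up to a single cell.\<close>
  also have "\<dots> \<le> (\<Prod>k<?d. if k < r then 2 * (\<sigma> (xs ! k) / a) else 1)"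
  proof (intro prod_mono conjI)
    fix k assume "k \<in> {..<?d}"
    then have k: "k < ?d" by simp
    show "real (N (xs ! k)) \<le> (if k < r then 2 * (\<sigma> (xs ! k) / a) else 1)"
    proof (cases "k < r")
      case True
      then have "1 \<le> \<sigma> (xs ! k) / a" using mono[of k r] r(2) a by (simp add: a_def)
      moreover from this have "real (N (xs ! k)) \<le> \<sigma> (xs ! k) / a + 1"
        unfolding N_def by linarith
      ultimately show ?thesis using True by simp
    next
      case False
      then have "\<sigma> (xs ! k) / a \<le> 1" using mono[of r k] k a by (simp add: a_def)
      then have "N (xs ! k) \<le> 1" unfolding N_def by linarith
      then show ?thesis using False by simp
    qed
  qed simp
  also have "\<dots> = (\<Prod>k<r. 2 * (\<sigma> (xs ! k) / a))"
  proof -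
    have "{..<?d} \<inter> {k. k < r} = {..<r}" using r(2) by auto
    then show ?thesis by (simp add: prod.If_cases)
  qed
  also have "\<dots> = 2 ^ r * (p / a ^ r)"
    by (simp add: p_def prod.distrib prod_dividef)
  also have "\<dots> \<le> 2 ^ ?d * (p / a ^ r)"
    using r(2) a \<open>a ^ r \<le> p\<close> by (intro mult_right_mono power_increasing) (auto intro!: divide_nonneg_nonneg intro: order_trans[of 0 "a ^ r"])
  finally have N_prod: "(\<Prod>i\<in>UNIV. real (N i)) \<le> 2 ^ ?d * (p / a ^ r)" .
  let ?D = "2 * R * real ?d * a"
  obtain P where P: "finite P" "card P \<le> (\<Prod>i\<in>UNIV. N i)"
    "{b + (\<Sum>i\<in>UNIV. y i *\<^sub>R (A *v v i)) | y. \<forall>i. \<bar>y i\<bar> \<le> R} \<subseteq> \<Union>P"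
    and U0: "\<forall>U\<in>P. bounded U \<and> diameter U \<le> (\<Sum>i\<in>UNIV. 2 * R / real (N i) * norm (A *v v i))"
    using parallelepiped_cover[OF R(1), where N = N and b = b and w = "\<lambda>i. A *v v i"] N_pos by blast
  have "(\<Sum>i\<in>UNIV. 2 * R / real (N i) * norm (A *v v i)) \<le> (\<Sum>i\<in>(UNIV::'d set). 2 * R * a)"
  proof (rule sum_mono)
    fix i
    have "\<sigma> i / real (N i) \<le> a"
      using N_ge[of i] N_pos[of i] a by (simp add: field_simps)
    then have "2 * R * (\<sigma> i / real (N i)) \<le> 2 * R * a"
      using R(1) by (intro mult_left_mono) auto
    then show "2 * R / real (N i) * norm (A *v v i) \<le> 2 * R * a"
      by (simp add: \<sigma>_def)
  qed
  also have "\<dots> = ?D" by simp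
  finally have U: "bounded U" "diameter U \<le> ?D" if "U \<in> P" for U
    using bspec[OF U0 that] by linarith+
  have cover: "(\<lambda>x. A *v x + b) ` J \<subseteq> \<Union>P"
  proof
    fix z assume "z \<in> (\<lambda>x. A *v x + b) ` J"
    then obtain x where x: "x \<in> J" "z = A *v x + b" by blast
    \<comment> \<open>The edges \<open>A *v v i\<close> are the images of unit vectors, and the
      coordinates of \<open>x\<close> along these are at most \<open>R\<close> by
      Cauchy-Schwarz.\<close>
    have "A *v x = (\<Sum>i\<in>UNIV. (v i \<bullet> x) *\<^sub>R (A *v v i))"
      by (subst v(1)[of x]) (simp add: linear_sum[OF matrix_vector_mul_linear] linear_cmul[OF matrix_vector_mul_linear])
    moreover have "\<bar>v i \<bullet> x\<bar> \<le> R" for i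
      using Cauchy_Schwarz_ineq2[of "v i" x] v(2)[of i] R(2)[OF x(1)] by simp
    ultimately have "z \<in> {b + (\<Sum>i\<in>UNIV. y i *\<^sub>R (A *v v i)) | y. \<forall>i. \<bar>y i\<bar> \<le> R}"
      using x(2) by (auto simp: add.commute)
    then show "z \<in> \<Union>P" using P(3) by blast
  qed
  have "(\<Sum>U\<in>P. ennreal (hausdorff_gauge s U)) \<le> (\<Sum>U\<in>P. ennreal (?D powr s))"
    using U s(1) by (intro sum_mono ennreal_leI hausdorff_gauge_le)
  also have "\<dots> = ennreal (real (card P) * ?D powr s)"
    by (simp add: ennreal_mult ennreal_of_nat_eq_real_of_nat)
  also have "\<dots> \<le> ennreal ((2 ^ ?d * (p / a ^ r)) * ?D powr s)"
  proof (intro ennreal_leI mult_right_mono)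
    have "real (card P) \<le> (\<Prod>i\<in>UNIV. real (N i))"
      using P(2) by (simp flip: of_nat_prod)
    then show "real (card P) \<le> 2 ^ ?d * (p / a ^ r)" using N_prod by linarith
  qed simp
  \<comment> \<open>Dividing \<open>a powr s\<close> by the \<open>a ^ r\<close> from the number of
    pieces leaves exactly the last factor of the singular value function.\<close>
  also have "(2 ^ ?d * (p / a ^ r)) * ?D powr s = ((2 * R * real ?d) powr s * 2 ^ ?d) * sing_val_fun s A"
  proof -
    have "?D powr s = (2 * R * real ?d) powr s * a powr s"
      using R(1) a by (intro powr_mult)
    then show ?thesis using a by (simp add: split \<phi>)
  qed
  also have "ennreal \<dots> = ennreal ((2 * R * real ?d) powr s * 2 ^ ?d) * ennreal (sing_val_fun s A)"
    using \<phi>_pos by (intro ennreal_mult) auto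
  finally have sum: "(\<Sum>U\<in>P. ennreal (hausdorff_gauge s U)) \<le>
      ennreal ((2 * R * real ?d) powr s * 2 ^ ?d) * ennreal (sing_val_fun s A)" .
  have "?D \<le> 2 * R * real ?d * sing_val_fun s A powr (1 / s)"
    using a_le' R(1) by (intro mult_left_mono) auto
  then have "\<forall>U\<in>P. bounded U \<and> diameter U \<le> 2 * R * real ?d * sing_val_fun s A powr (1 / s)"
    using U by (meson order_trans)
  then show ?thesis using P(1) cover \<phi>_pos sum by blast
qed

section \<open>Affine sets and their codings\<close>

text \<open>Composition multiplies the linear parts in the same order. The index list is arbitrary
  because the induction runs over positions while the word stays fixed; for covering, only the
  existence of a translation matters.\<close>

lemma foldr_affine_eq:
  fixes A :: "'i \<Rightarrow> real^'d^'d"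
  assumes F: "\<And>j x. F j x = A j *v x + c j"
  shows "\<exists>b. \<forall>x. foldr (\<circ>) (map F js) id x = foldr (**) (map A js) (mat 1) *v x + b"
proof (induction js)
  case (Cons j js)
  let ?M = "foldr (**) (map A js) (mat 1)"
  obtain b where b: "\<And>x. foldr (\<circ>) (map F js) id x = ?M *v x + b"
    using Cons by blast
  have eq: "foldr (\<circ>) (map F (j # js)) id x =
      foldr (**) (map A (j # js)) (mat 1) *v x + (A j *v b + c j)" for x
  proof -
    have "foldr (\<circ>) (map F (j # js)) id x = F j (foldr (\<circ>) (map F js) id x)" by simp
    also have "\<dots> = A j *v (?M *v x + b) + c j" by (subst b, rule F)
    also have "\<dots> = foldr (**) (map A (j # js)) (mat 1) *v x + (A j *v b + c j)"
      by (simp add: matrix_vector_right_distrib matrix_vector_mul_assoc)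
    finally show ?thesis .
  qed
  show ?case
    by (intro exI allI) (rule eq)
qed simp

lemma affine_map_eq: "\<exists>b. \<forall>x. affine_map T \<omega> u x = word_matrix T u *v x + b"
  unfolding affine_map_def word_matrix_def by (rule foldr_affine_eq) (rule affine_step_def)

lemma invertible_word_matrix:
  assumes "\<And>k i. 1 \<le> k \<Longrightarrow> i \<in> {1..n k} \<Longrightarrow> invertible (T k i)" and "u \<in> fin_words n"
  shows "invertible (word_matrix T u)"
proof -
  have "\<forall>j\<in>set [1..<Suc (length u)]. invertible (T j (u ! (j - 1)))"
    using assms by (auto simp: fin_words_def words_def)
  moreover have "invertible (foldr (**) (map (\<lambda>j. T j (u ! (j - 1))) js) (mat 1))"
    if "\<forall>j\<in>set js. invertible (T j (u ! (j - 1)))" for js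
    using that by (induction js) (auto intro: invertible_mult simp: invertible_def[of "mat 1"] intro!: exI[of _ "mat 1"])
  ultimately show ?thesis unfolding word_matrix_def by blast
qed

lemma take_in_words:
  assumes "v \<in> words n k" "i \<le> k"
  shows "take i v \<in> words n i"
  using assms by (auto simp: words_def)

section \<open>Coding of points by infinite words\<close>

context nonautonomous_affine_system
begin

lemma Jw_subset_take:
  assumes "v \<in> words n k" "i \<le> k"
  shows "Jw v \<subseteq> Jw (take i v)"
  using assms(2)
proof (induction rule: inc_induct)
  case base
  then show ?case using assms(1) by (simp add: words_def)
next
  case (step i)
  have "take i v \<in> words n i" using take_in_words assms(1) step by simp
  \<comment> \<open>Positions count from 0 and levels from 1, so the letter at position
    \<open>i\<close> belongs to level \<open>Suc i\<close>.\<close>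
  moreover have "v ! i \<in> {1..n (Suc i)}"
    using assms(1) step by (force simp: words_def dest: bspec[of _ _ "Suc i"])
  moreover have "take (Suc i) v = take i v @ [v ! i]"
    using assms(1) step by (simp add: words_def take_Suc_conv_app_nth)
  ultimately have "Jw (take (Suc i) v) \<subseteq> Jw (take i v)"
    using Jw_nested[of "Suc i" "take i v" "v ! i"] by simp
  then show ?case using step by blast
qed

text \<open>The definition of the affine set supplies a word of each length, but these need not
  extend one another, whereas cylinder covers speak of infinite words.\<close>

lemma exists_coding:
  assumes x: "x \<in> nonautonomous_affine_set n Jw"
  shows "\<exists>w\<in>inf_words n. \<forall>k. x \<in> Jw (map w [0..<k])"
proof -
  txt \<open>Koenig's lemma: \<open>u\<close> is good if it has extensions \<open>v\<close> of every length with \<open>x \<in> Jw v\<close>.\<close>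
  define good where "good u \<longleftrightarrow> (\<forall>k>length u. \<exists>v\<in>words n k. take (length u) v = u \<and> x \<in> Jw v)" for u
  \<comment> \<open>The strict inequality in \<open>good\<close> fits the intersection defining the
    affine set, which starts at level 1.\<close>
  have good_Nil: "good []"
    using x unfolding good_def nonautonomous_affine_set_def by force
  have good_step: "\<exists>j\<in>{1..n (Suc (length u))}. good (u @ [j])" if u: "good u" for u
  proof (rule ccontr)
    let ?l = "Suc (length u)"
    assume "\<not> (\<exists>j\<in>{1..n ?l}. good (u @ [j]))"
    then have "\<forall>j\<in>{1..n ?l}. \<exists>k>?l. \<forall>v\<in>words n k. take ?l v = u @ [j] \<longrightarrow> x \<notin> Jw v"
      by (auto simp: good_def)
    then obtain k where k: "\<And>j. j \<in> {1..n ?l} \<Longrightarrow> k j > ?l"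
      "\<And>j v. j \<in> {1..n ?l} \<Longrightarrow> v \<in> words n (k j) \<Longrightarrow> take ?l v = u @ [j] \<Longrightarrow> x \<notin> Jw v"
      by metis
    \<comment> \<open>The alphabet is finite, so one level is at least all the failure levels
      \<open>k j\<close>. A word of that length continues \<open>u\<close> by some letter
      \<open>j\<close>, and its truncation to length \<open>k j\<close> contradicts the failure for
      \<open>j\<close>.\<close>
    define K where "K = Max (insert ?l (k ` {1..n ?l}))"
    have K: "?l \<le> K" "\<And>j. j \<in> {1..n ?l} \<Longrightarrow> k j \<le> K"
      unfolding K_def by (rule Max_ge; simp)+
    then obtain v where v: "v \<in> words n K" "take (length u) v = u" "x \<in> Jw v"
      using u unfolding good_def by (meson Suc_le_lessD)
    define j where "j = v ! length u"
    have j: "j \<in> {1..n ?l}"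
      using v(1) K(1) by (force simp: words_def j_def dest: bspec[of _ _ ?l])
    have "take ?l (take (k j) v) = u @ [j]"
      using k(1)[OF j] v K(1) by (simp add: min_def words_def take_Suc_conv_app_nth j_def)
    moreover have "take (k j) v \<in> words n (k j)" "x \<in> Jw (take (k j) v)"
      using take_in_words[OF v(1)] Jw_subset_take[OF v(1)] K(2)[OF j] v(3) by auto
    ultimately show False using k(2)[OF j] by blast
  qed
  have "\<exists>f. \<forall>k. (length (f k) = k \<and> good (f k)) \<and>
      (\<exists>j\<in>{1..n (Suc k)}. f (Suc k) = f k @ [j])"
  proof (rule dependent_nat_choice)
    show "\<exists>u. length u = 0 \<and> good u" using good_Nil by simp
    fix u k assume u: "length u = k \<and> good u"
    then obtain j where "j \<in> {1..n (Suc k)}" "good (u @ [j])" using good_step by blast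
    then show "\<exists>v. (length v = Suc k \<and> good v) \<and> (\<exists>j\<in>{1..n (Suc k)}. v = u @ [j])"
      using u by (intro exI[of _ "u @ [j]"]) simp
  qed
  then obtain f where f: "\<And>k. length (f k) = k" "\<And>k. good (f k)"
      "\<And>k. \<exists>j\<in>{1..n (Suc k)}. f (Suc k) = f k @ [j]"
    by blast
  define w where "w k = last (f (Suc k))" for k
  have w: "w k \<in> {1..n (Suc k)}" "f (Suc k) = f k @ [w k]" for k
    using f(3)[of k] by (auto simp: w_def)
  have "f 0 = []" using f(1)[of 0] by simp
  then have map_w: "map w [0..<k] = f k" for k
    by (induction k) (auto simp: w(2))
  \<comment> \<open>Goodness concerns strictly longer words only, so take an extension by one letter
    and use nesting.\<close>
  have "x \<in> Jw (f k)" for k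
  proof -
    obtain v where "v \<in> words n (Suc k)" "take k v = f k" "x \<in> Jw v"
      using f(1,2)[of k] unfolding good_def by (metis lessI)
    then show ?thesis using Jw_subset_take[of v "Suc k" k] by auto
  qed
  moreover have "w \<in> inf_words n"
    unfolding inf_words_def using w(1) by (auto simp: Suc_le_eq gr0_conv_Suc)
  ultimately show ?thesis by (auto simp: map_w intro!: bexI[of _ w])
qed

lemma inf_words_nonempty: "inf_words n \<noteq> {}"
proof -
  have "(\<lambda>_. 1) \<in> inf_words n"
    unfolding inf_words_def using two_le_n by fastforce
  then show ?thesis by blast
qed

text \<open>A coding word of the point lies in one of the cylinders, so some word of
  \<open>C\<close> is a prefix of it.\<close>

lemma affine_set_subset_cover:
  assumes "inf_words n \<subseteq> (\<Union>u\<in>C. cylinder n u)"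
  shows "nonautonomous_affine_set n Jw \<subseteq> (\<Union>u\<in>C. Jw u)"
proof
  fix x assume "x \<in> nonautonomous_affine_set n Jw"
  then obtain w where w: "w \<in> inf_words n" "\<And>k. x \<in> Jw (map w [0..<k])"
    using exists_coding by blast
  then obtain u where "u \<in> C" "map w [0..<length u] = u"
    using assms unfolding cylinder_def by blast
  then show "x \<in> (\<Union>u\<in>C. Jw u)" using w(2)[of "length u"] by auto
qed

lemma bounded_affine_set: "bounded (nonautonomous_affine_set n Jw)"
proof (rule bounded_subset)
  show "bounded J" using compact_J by (rule compact_imp_bounded)
  show "nonautonomous_affine_set n Jw \<subseteq> J"
    using Jw_subset_J by (force simp: nonautonomous_affine_set_def fin_words_def)
qed

section \<open>Comparison of Hausdorff measure with the net measure\<close>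

lemma small_cover:
  assumes "net_measure n T s (inf_words n) = 0" "0 < \<epsilon>"
  obtains C where "C \<subseteq> fin_words n" "inf_words n \<subseteq> (\<Union>u\<in>C. cylinder n u)"
    "(\<Sum>\<^sub>\<infinity>u\<in>C. ennreal (sing_val_fun s (word_matrix T u))) < ennreal \<epsilon>"
proof -
  \<comment> \<open>The premeasures increase with the level, so the one at level 0 is at most their
    limit. Diameters will be controlled through the size of the sum.\<close>
  have "net_premeasure n T s 0 (inf_words n) \<le> net_measure n T s (inf_words n)"
    unfolding net_measure_eq_SUP by (rule SUP_upper) simp
  then have "net_premeasure n T s 0 (inf_words n) < ennreal \<epsilon>"
    using assms by simp
  then show thesis
    unfolding net_premeasure_def Inf_less_iff using that by blast
qed

lemma hausdorff_measure_eq_0: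
  assumes inv: "\<And>k i. 1 \<le> k \<Longrightarrow> i \<in> {1..n k} \<Longrightarrow> invertible (T k i)"
    and s: "0 < s" "s \<le> real CARD('d)" and net: "net_measure n T s (inf_words n) = 0"
  shows "hausdorff_measure s (nonautonomous_affine_set n Jw) = 0"
proof -
  let ?E = "nonautonomous_affine_set n Jw"
  let ?\<phi> = "\<lambda>u. sing_val_fun s (word_matrix T u)"
  obtain R where R: "0 < R" "\<And>x. x \<in> J \<Longrightarrow> norm x \<le> R"
    using compact_imp_bounded[OF compact_J] unfolding bounded_pos by blast
  obtain \<omega> where \<omega>: "\<And>u. u \<in> fin_words n \<Longrightarrow> Jw u = affine_map T \<omega> u ` J"
    using Jw_affine by blast
  define c where "c = 2 * R * real CARD('d)"
  define K where "K = c powr s * 2 ^ CARD('d)"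
  have c: "0 < c" and K: "0 < K" using R(1) by (simp_all add: c_def K_def)
  have ex: "\<exists>P. finite P \<and> Jw u \<subseteq> \<Union>P \<and> 0 < ?\<phi> u \<and>
      (\<forall>U\<in>P. bounded U \<and> diameter U \<le> c * ?\<phi> u powr (1 / s)) \<and>
      (\<Sum>U\<in>P. ennreal (hausdorff_gauge s U)) \<le> ennreal K * ennreal (?\<phi> u)"
    if u: "u \<in> fin_words n" for u
  proof -
    obtain b where "\<forall>x. affine_map T \<omega> u x = word_matrix T u *v x + b"
      using affine_map_eq by blast
    then have "Jw u = (\<lambda>x. word_matrix T u *v x + b) ` J" by (simp add: \<omega>[OF u])
    moreover have "invertible (word_matrix T u)" using invertible_word_matrix inv u by blast
    ultimately show ?thesis
      using affine_image_cover[of "word_matrix T u" R J s b] R s unfolding K_def c_def by simp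
  qed
  then obtain P where P: "\<And>u. u \<in> fin_words n \<Longrightarrow> finite (P u) \<and> Jw u \<subseteq> \<Union>(P u) \<and> 0 < ?\<phi> u \<and>
      (\<forall>U\<in>P u. bounded U \<and> diameter U \<le> c * ?\<phi> u powr (1 / s)) \<and>
      (\<Sum>U\<in>P u. ennreal (hausdorff_gauge s U)) \<le> ennreal K * ennreal (?\<phi> u)"
    by metis
  have "hausdorff_premeasure s \<delta> ?E = 0" if \<delta>: "0 < \<delta>" for \<delta>
  proof -
    have "hausdorff_premeasure s \<delta> ?E \<le> 0 + ennreal e" if e: "0 < e" for e
    proof -
      \<comment> \<open>The first term forces every piece to have diameter at most
        \<open>\<delta>\<close>; the second makes the gauges sum to at most
        \<open>e\<close>.\<close>
      define \<epsilon> where "\<epsilon> = min ((\<delta> / c) powr s) (e / K)"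
      have \<epsilon>: "0 < \<epsilon>" using \<delta> c K e by (simp add: \<epsilon>_def)
      obtain C where C: "C \<subseteq> fin_words n" "inf_words n \<subseteq> (\<Union>u\<in>C. cylinder n u)"
        "(\<Sum>\<^sub>\<infinity>u\<in>C. ennreal (?\<phi> u)) < ennreal \<epsilon>"
        using small_cover[OF net \<epsilon>] by blast
      have PC: "finite (P u)" "Jw u \<subseteq> \<Union>(P u)" "0 < ?\<phi> u"
        "\<And>U. U \<in> P u \<Longrightarrow> bounded U \<and> diameter U \<le> c * ?\<phi> u powr (1 / s)"
        "(\<Sum>U\<in>P u. ennreal (hausdorff_gauge s U)) \<le> ennreal K * ennreal (?\<phi> u)"
        if "u \<in> C" for u
        using P[OF subsetD[OF C(1) that]] by simp_all
      \<comment> \<open>A single term of a nonnegative sum is at most the sum.\<close>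
      have \<phi>_less: "?\<phi> u < \<epsilon>" if "u \<in> C" for u
      proof -
        have "ennreal (?\<phi> u) = (\<Sum>\<^sub>\<infinity>u\<in>{u}. ennreal (?\<phi> u))" by simp
        also have "\<dots> \<le> (\<Sum>\<^sub>\<infinity>u\<in>C. ennreal (?\<phi> u))"
          using that by (intro infsum_mono_neutral) (auto simp: nonneg_summable_on_complete)
        finally have "ennreal (?\<phi> u) < ennreal \<epsilon>" using C(3) by (rule le_less_trans)
        moreover have "0 \<le> ?\<phi> u" using PC(3)[OF that] by simp
        ultimately show ?thesis by (simp add: ennreal_less_iff)
      qed
      have "(\<Union>u\<in>C. Jw u) \<subseteq> (\<Union>u\<in>C. \<Union>(P u))"
        by (intro UN_mono order_refl PC)
      with affine_set_subset_cover[OF C(2)] have "?E \<subseteq> (\<Union>u\<in>C. \<Union>(P u))"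
        by (rule order_trans)
      moreover have "bounded U \<and> diameter U \<le> \<delta>" if u: "u \<in> C" "U \<in> P u" for u U
      proof -
        have Pu: "0 < ?\<phi> u" "bounded U" "diameter U \<le> c * ?\<phi> u powr (1 / s)"
          using PC(3,4)[OF u(1)] u(2) by simp_all
        have "?\<phi> u \<le> (\<delta> / c) powr s" using \<phi>_less[OF u(1)] by (simp add: \<epsilon>_def)
        then have "?\<phi> u powr (1 / s) \<le> ((\<delta> / c) powr s) powr (1 / s)"
          using Pu(1) s(1) by (intro powr_mono2) auto
        also have "\<dots> = \<delta> / c" using \<delta> c s(1) by (simp add: powr_powr)
        finally have "c * ?\<phi> u powr (1 / s) \<le> \<delta>" using c by (simp add: field_simps)
        then show ?thesis using Pu by linarith
      qed
      ultimately have "hausdorff_premeasure s \<delta> ?E \<le>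
          (\<Sum>\<^sub>\<infinity>u\<in>C. \<Sum>U\<in>P u. ennreal (hausdorff_gauge s U))"
        using PC(1) less_imp_le[OF \<delta>] by (intro hausdorff_premeasure_le_infsum)
      also have "\<dots> \<le> (\<Sum>\<^sub>\<infinity>u\<in>C. ennreal K * ennreal (?\<phi> u))"
        using PC(5) by (intro infsum_mono) (simp_all add: nonneg_summable_on_complete)
      also have "\<dots> = ennreal K * (\<Sum>\<^sub>\<infinity>u\<in>C. ennreal (?\<phi> u))"
        by (rule infsum_cmult_right_ennreal)
      also have "\<dots> \<le> ennreal K * ennreal \<epsilon>"
        using C(3) by (intro mult_left_mono) auto
      also have "\<dots> = ennreal (K * \<epsilon>)" using K by (simp add: ennreal_mult')
      also have "\<dots> \<le> ennreal e"
      proof (rule ennreal_leI)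
        have "\<epsilon> \<le> e / K" by (simp add: \<epsilon>_def)
        then show "K * \<epsilon> \<le> e" using K by (simp add: field_simps)
      qed
      finally show ?thesis by simp
    qed
    then have "hausdorff_premeasure s \<delta> ?E \<le> 0" by (rule ennreal_le_epsilon)
    then show ?thesis by simp
  qed
  then show ?thesis
    unfolding hausdorff_measure_def by (auto intro!: antisym SUP_least)
qed

text \<open>At exponent 0 every word contributes 1, and a cover of a nonempty set uses at least one
  word. This excludes the exponent for which the diameter bound with \<open>1 / s\<close> makes no
  sense.\<close>

lemma net_measure_0_nonzero: "net_measure n T 0 (inf_words n) \<noteq> 0"
proof
  assume "net_measure n T 0 (inf_words n) = 0"
  then obtain C where C: "inf_words n \<subseteq> (\<Union>u\<in>C. cylinder n u)"
    "(\<Sum>\<^sub>\<infinity>u\<in>C. ennreal (sing_val_fun 0 (word_matrix T u))) < ennreal 1"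
    by (rule small_cover[OF _ zero_less_one]) auto
  then obtain u where u: "u \<in> C" using inf_words_nonempty by blast
  have "ennreal 1 = (\<Sum>\<^sub>\<infinity>u\<in>{u}. ennreal (sing_val_fun 0 (word_matrix T u)))"
    by (simp add: sing_val_fun_def)
  also have "\<dots> \<le> (\<Sum>\<^sub>\<infinity>u\<in>C. ennreal (sing_val_fun 0 (word_matrix T u)))"
    using u by (intro infsum_mono_neutral) (auto simp: nonneg_summable_on_complete)
  finally show False using C(2) by simp
qed

end

section \<open>From vanishing measures to the inequality of dimensions\<close>

theorem theorem2p6:
  fixes n :: "nat \<Rightarrow> nat"
    and T :: "nat \<Rightarrow> nat \<Rightarrow> real^'d^'d"
    and J :: "(real^'d) set"
    and Jw :: "nat list \<Rightarrow> (real^'d) set"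
  assumes "nonautonomous_affine_system n T J Jw"
    and "\<And>k i. 1 \<le> k \<Longrightarrow> i \<in> {1..n k} \<Longrightarrow> invertible (T k i)"
    and "0 < alpha_minus n T" and "alpha_minus n T \<le> alpha_plus n T" and "alpha_plus n T < 1"
  shows "hausdorff_dim (nonautonomous_affine_set n Jw) \<le> min (affinity_dim n T) (of_nat CARD('d))"
proof -
  interpret nonautonomous_affine_system n T J Jw by fact
  let ?E = "nonautonomous_affine_set n Jw"
  have dim_le: "hausdorff_dim ?E \<le> of_nat CARD('d)"
    using bounded_affine_set by (rule hausdorff_dim_le_CARD)
  \<comment> \<open>It suffices to treat each exponent in the infimum defining
    \<open>affinity_dim\<close>; if there are none, that infimum is infinite.\<close>
  have "hausdorff_dim ?E \<le> ennreal s"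
    if s: "0 \<le> s" "net_measure n T s (inf_words n) = 0" for s
  proof (cases "s \<le> real CARD('d)")
    case True
    have "0 < s" using s net_measure_0_nonzero by (cases "s = 0") auto
    then have "hausdorff_measure s ?E = 0"
      using hausdorff_measure_eq_0 assms(2) True s(2) by blast
    then show ?thesis
      using s(1) unfolding hausdorff_dim_def by (intro Inf_lower) blast
  next
    \<comment> \<open>Beyond \<open>d\<close> the bound by the dimension of the space is already the
      stronger one.\<close>
    case False
    then have "ennreal (real CARD('d)) \<le> ennreal s" by (intro ennreal_leI) simp
    then show ?thesis
      using dim_le unfolding ennreal_of_nat_eq_real_of_nat by (rule order_trans[rotated])
  qed
  then have "hausdorff_dim ?E \<le> affinity_dim n T"
    unfolding affinity_dim_def by (intro Inf_greatest) blast
  then show ?thesis using dim_le by simp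
qed

end
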